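(* If $(\mathcal{P}_n)_{n\ge1}$ is a good sequence of configurations of polygons, then the surface $\mathbf{M}_{\mathcal{P}_n}$ obtained by the uniform random gluing of the sides of the polygons of $\mathcal{P}_n$ is connected with high probability, i.e. $\mathbb{P}(\mathbf{M}_{\mathcal{P}_n}\text{ is connected})\to1$ as $n\to\infty$.
   Context: A configuration of polygons is a finite multiset $\mathcal{P}=\{p_1,\dots,p_k\}$ of positive integers with even sum; $|\mathcal{P}|=\frac12\sum_ip_i$, $\mathsf{L}(\mathcal{P})=\#\{i:p_i=1\}$, $\mathsf{B}(\mathcal{P})=\#\{i:p_i=2\}$. A sequence $(\mathcal{P}_n)_{n\ge1}$ with $|\mathcal{P}_n|=n$ is good if $\mathsf{L}(\mathcal{P}_n)/\sqrt n\to0$ and $\mathsf{B}(\mathcal{P}_n)/n\to0$. Random gluing: given $\mathcal{P}$ with $|\mathcal{P}|=n$, take oriented polygons of perimeters $p_1,\dots,p_k$, label their sides by $1,\dots,2n$ uniformly at random, let $\phi$ be the permutation of $\{1,\dots,2n\}$ sending each side to the next one around its polygon, and glue side $i$ to side $\omega(i)$ for all $i$ (respecting orientations), where $\omega$ is an independent uniform fixed-point-free involution of $\{1,\dots,2n\}$. The resulting surface is connected if and only if the subgroup generated by $\phi$ and $\omega$ acts transitively on $\{1,\dots,2n\}$. *)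

theory Defs
  imports "HOL-Probability.Probability" "HOL-Combinatorics.Permutations"
begin

section \<open>Configurations of polygons\<close>

definition configuration :: "nat multiset \<Rightarrow> bool" where
  "configuration P \<longleftrightarrow> (\<forall>p\<in>#P. 0 < p) \<and> even (\<Sum>\<^sub># P)"

definition config_size :: "nat multiset \<Rightarrow> nat" where
  "config_size P = \<Sum>\<^sub># P div 2"

definition num_loops :: "nat multiset \<Rightarrow> nat" where
  "num_loops P = count P 1"

definition num_bigons :: "nat multiset \<Rightarrow> nat" where
  "num_bigons P = count P 2"

text \<open>The value at index 0 is irrelevant.\<close>

definition good :: "(nat \<Rightarrow> nat multiset) \<Rightarrow> bool" where
  "good P \<longleftrightarrow>
     (\<forall>n\<ge>1. configuration (P n) \<and> config_size (P n) = n) \<and>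
     (\<lambda>n. real (num_loops (P n)) / sqrt (real n)) \<longlonglongrightarrow> 0 \<and>
     (\<lambda>n. real (num_bigons (P n)) / real n) \<longlonglongrightarrow> 0"


section \<open>Labelled sides and pairings\<close>

text \<open>The polygons of \<open>P\<close> are numbered from 0 in increasing order of perimeter; side \<open>(i, j)\<close>
  is the \<open>j\<close>-th side of polygon \<open>i\<close>, in the order given by the orientation.\<close>

definition num_polygons :: "nat multiset \<Rightarrow> nat" where
  "num_polygons P = size P"

definition perimeter :: "nat multiset \<Rightarrow> nat \<Rightarrow> nat" where
  "perimeter P i = sorted_list_of_multiset P ! i"

definition sides :: "nat multiset \<Rightarrow> (nat \<times> nat) set" where
  "sides P = (SIGMA i:{..<num_polygons P}. {..<perimeter P i})"

definition next_side :: "nat multiset \<Rightarrow> nat \<times> nat \<Rightarrow> nat \<times> nat" where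
  "next_side P = (\<lambda>(i, j). (i, Suc j mod perimeter P i))"

definition labellings :: "nat multiset \<Rightarrow> (nat \<times> nat \<Rightarrow> nat) set" where
  "labellings P = {l \<in> extensional (sides P). bij_betw l (sides P) {1..\<Sum>\<^sub># P}}"

text \<open>The permutation that the labelled polygons induce on the labels.\<close>

definition polygon_perm :: "nat multiset \<Rightarrow> (nat \<times> nat \<Rightarrow> nat) \<Rightarrow> nat \<Rightarrow> nat" where
  "polygon_perm P l x = l (next_side P (inv_into (sides P) l x))"

definition pairings :: "nat \<Rightarrow> (nat \<Rightarrow> nat) set" where
  "pairings m = {w. w permutes {1..m} \<and> (\<forall>x\<in>{1..m}. w (w x) = x \<and> w x \<noteq> x)}"


section \<open>The glued surface\<close>

text \<open>The quotient topology induced by \<open>f\<close> on the image of \<open>X\<close>, with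
  \<open>openin_quotient_topology\<close> and \<open>quotient_map_quotient_topology\<close> below.\<close>

definition quotient_topology :: "'a topology \<Rightarrow> ('a \<Rightarrow> 'b) \<Rightarrow> 'b topology" where
  "quotient_topology X f =
     topology (\<lambda>U. U \<subseteq> f ` topspace X \<and> openin X {x \<in> topspace X. f x \<in> U})"

lemma openin_quotient_topology:
  "openin (quotient_topology X f) U \<longleftrightarrow>
     U \<subseteq> f ` topspace X \<and> openin X {x \<in> topspace X. f x \<in> U}"
proof -
  have "istopology (\<lambda>U. U \<subseteq> f ` topspace X \<and> openin X {x \<in> topspace X. f x \<in> U})"
    unfolding istopology_def
  proof (intro conjI allI impI)
    fix S T
    assume "S \<subseteq> f ` topspace X \<and> openin X {x \<in> topspace X. f x \<in> S}"
      and "T \<subseteq> f ` topspace X \<and> openin X {x \<in> topspace X. f x \<in> T}"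
    moreover have "{x \<in> topspace X. f x \<in> S \<inter> T} =
        {x \<in> topspace X. f x \<in> S} \<inter> {x \<in> topspace X. f x \<in> T}" by auto
    ultimately show "S \<inter> T \<subseteq> f ` topspace X" "openin X {x \<in> topspace X. f x \<in> S \<inter> T}"
      by (auto simp only: openin_Int)
  next
    fix K
    assume K: "\<forall>U\<in>K. U \<subseteq> f ` topspace X \<and> openin X {x \<in> topspace X. f x \<in> U}"
    then show "\<Union>K \<subseteq> f ` topspace X" by blast
    have "{x \<in> topspace X. f x \<in> \<Union>K} = (\<Union>U\<in>K. {x \<in> topspace X. f x \<in> U})" by auto
    then show "openin X {x \<in> topspace X. f x \<in> \<Union>K}" using K by auto
  qed
  then show ?thesis unfolding quotient_topology_def by (simp add: topology_inverse')
qed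

lemma topspace_quotient_topology [simp]:
  "topspace (quotient_topology X f) = f ` topspace X"
proof (rule antisym)
  show "topspace (quotient_topology X f) \<subseteq> f ` topspace X"
    by (auto simp: topspace_def openin_quotient_topology)
  have "{x \<in> topspace X. f x \<in> f ` topspace X} = topspace X" by auto
  then have "openin (quotient_topology X f) (f ` topspace X)"
    by (simp add: openin_quotient_topology)
  then show "f ` topspace X \<subseteq> topspace (quotient_topology X f)"
    by (rule openin_subset)
qed

lemma quotient_map_quotient_topology: "quotient_map X (quotient_topology X f) f"
  by (auto simp: quotient_map_def openin_quotient_topology)

text \<open>A polygon of perimeter \<open>p\<close> is the closed unit disc with its boundary circle, traversed
  counterclockwise, divided into \<open>p\<close> equal arcs. This also covers \<open>p = 1\<close> and \<open>p = 2\<close>.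
  The point at parameter \<open>t \<in> [0, 1]\<close> of the \<open>j\<close>-th arc is \<open>side_point p j t\<close>.\<close>

definition side_point :: "nat \<Rightarrow> nat \<Rightarrow> real \<Rightarrow> complex" where
  "side_point p j t = cis (2 * pi * (real j + t) / real p)"

definition polygons :: "nat multiset \<Rightarrow> (nat \<times> complex) topology" where
  "polygons P = sum_topology (\<lambda>_. top_of_set (cball 0 1)) {..<num_polygons P}"

text \<open>Paired sides are identified with opposite directions, which is what makes the gluing
  compatible with the orientations of the polygons.\<close>

definition side_gluing ::
    "nat multiset \<Rightarrow> (nat \<times> nat \<Rightarrow> nat) \<Rightarrow> (nat \<Rightarrow> nat) \<Rightarrow> (nat \<times> complex) rel" where
  "side_gluing P l w =
     {((i, side_point (perimeter P i) j t), (i', side_point (perimeter P i') j' (1 - t)))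
       | i j i' j' t.
         (i, j) \<in> sides P \<and> (i', j') \<in> sides P \<and> w (l (i, j)) = l (i', j') \<and> t \<in> {0..1}}"

text \<open>Points of the surface are the classes of the equivalence relation generated by the
  identifications.\<close>

definition gluing_class ::
    "nat multiset \<Rightarrow> (nat \<times> nat \<Rightarrow> nat) \<Rightarrow> (nat \<Rightarrow> nat) \<Rightarrow> nat \<times> complex \<Rightarrow> (nat \<times> complex) set" where
  "gluing_class P l w x = (side_gluing P l w \<union> (side_gluing P l w)\<inverse>)\<^sup>* `` {x}"

definition glued_surface ::
    "nat multiset \<Rightarrow> (nat \<times> nat \<Rightarrow> nat) \<Rightarrow> (nat \<Rightarrow> nat) \<Rightarrow> (nat \<times> complex) set topology" where
  "glued_surface P l w = quotient_topology (polygons P) (gluing_class P l w)"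

definition random_surface :: "nat multiset \<Rightarrow> (nat \<times> complex) set topology pmf" where
  "random_surface P =
     map_pmf (\<lambda>(l, w). glued_surface P l w)
       (pair_pmf (pmf_of_set (labellings P)) (pmf_of_set (pairings (\<Sum>\<^sub># P))))"


section \<open>The uniform distributions are well defined\<close>

lemma finite_sides: "finite (sides P)"
  by (simp add: sides_def)

lemma card_sides: "card (sides P) = \<Sum>\<^sub># P"
proof -
  have "card (sides P) = (\<Sum>i<length (sorted_list_of_multiset P). sorted_list_of_multiset P ! i)"
    by (simp add: sides_def num_polygons_def perimeter_def flip: size_mset)
  also have "\<dots> = sum_list (sorted_list_of_multiset P)"
    by (simp add: sum_list_sum_nth atLeast0LessThan)
  also have "\<dots> = \<Sum>\<^sub># P" by (simp flip: sum_mset_sum_list)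
  finally show ?thesis .
qed

lemma finite_labellings: "finite (labellings P)"
proof (rule finite_subset)
  show "labellings P \<subseteq> sides P \<rightarrow>\<^sub>E {1..\<Sum>\<^sub># P}"
    by (auto simp: labellings_def PiE_def bij_betw_def)
  show "finite (sides P \<rightarrow>\<^sub>E {1..\<Sum>\<^sub># P})" by (intro finite_PiE finite_sides) simp
qed

lemma labellings_nonempty: "labellings P \<noteq> {}"
proof -
  have "card (sides P) = card {1..\<Sum>\<^sub># P}" by (simp add: card_sides)
  then obtain l where "bij_betw l (sides P) {1..\<Sum>\<^sub># P}"
    using finite_same_card_bij[OF finite_sides, of "{1..\<Sum>\<^sub># P}"] by auto
  then have "restrict l (sides P) \<in> labellings P"
    by (auto simp: labellings_def cong: bij_betw_cong)
  then show ?thesis by blast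
qed

lemma finite_pairings: "finite (pairings m)"
  by (rule finite_subset[OF _ finite_permutations[of "{1..m}"]]) (auto simp: pairings_def)

lemma pairings_nonempty:
  assumes "even m" shows "pairings m \<noteq> {}"
proof -
  define w where "w x = (if x \<in> {1..m} then (if even x then x - 1 else x + 1) else x)" for x
  have 1: "w x \<in> {1..m}" "w (w x) = x" "w x \<noteq> x" if "x \<in> {1..m}" for x
    using that assms by (auto simp: w_def elim!: evenE oddE) presburger+
  have "bij_betw w {1..m} {1..m}"
    by (rule bij_betwI[where g = w]) (use 1 in auto)
  then have "w permutes {1..m}"
    by (rule bij_imp_permutes) (auto simp: w_def)
  with 1 show ?thesis by (auto simp: pairings_def)
qed


section \<open>Connectedness in terms of permutations\<close>

text \<open>On a finite set, orbits of the group generated by the two permutations are the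
  classes of forward reachability.\<close>

definition label_steps :: "nat multiset \<Rightarrow> (nat \<times> nat \<Rightarrow> nat) \<Rightarrow> (nat \<Rightarrow> nat) \<Rightarrow> nat rel" where
  "label_steps P l w =
     {(x, y). x \<in> {1..\<Sum>\<^sub># P} \<and> (y = polygon_perm P l x \<or> y = w x)}"

lemma perimeter_pos:
  assumes "configuration P" "i < num_polygons P"
  shows "0 < perimeter P i"
proof -
  have "i < length (sorted_list_of_multiset P)"
    using assms(2) by (simp add: num_polygons_def flip: size_mset)
  then have "perimeter P i \<in> set (sorted_list_of_multiset P)"
    unfolding perimeter_def by (rule nth_mem)
  then show ?thesis using assms(1) by (simp add: configuration_def)
qed

lemma polygon_perm_label:
  assumes "l \<in> labellings P" "s \<in> sides P"
  shows "polygon_perm P l (l s) = l (next_side P s)"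
  using assms by (simp add: polygon_perm_def labellings_def bij_betw_def inv_into_f_f)

lemma next_side_in_sides:
  assumes "configuration P" "s \<in> sides P" shows "next_side P s \<in> sides P"
  using assms perimeter_pos by (auto simp: sides_def next_side_def)

lemma inj_on_next_side: "inj_on (next_side P) (sides P)"
proof (rule inj_onI)
  fix s s' assume s: "s \<in> sides P" "s' \<in> sides P" "next_side P s = next_side P s'"
  obtain i j i' j' where ij: "s = (i, j)" "s' = (i', j')" by (cases s, cases s')
  then have "i = i'" "j < perimeter P i" "j' < perimeter P i"
    "Suc j mod perimeter P i = Suc j' mod perimeter P i"
    using s by (auto simp: sides_def next_side_def)
  then show "s = s'" using ij
    by (auto simp: mod_Suc split: if_splits)
qed

lemma norm_side_point: "norm (side_point p j t) = 1"
  by (simp add: side_point_def)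

lemma topspace_polygons: "topspace (polygons P) = {..<num_polygons P} \<times> cball 0 1"
  by (simp add: polygons_def)

lemma connected_glued_surface_imp_transitive:
  assumes P: "configuration P" and l: "l \<in> labellings P" and w: "w \<in> pairings (\<Sum>\<^sub># P)"
    and conn: "connected_space (glued_surface P l w)"
    and x: "x \<in> {1..\<Sum>\<^sub># P}" and y: "y \<in> {1..\<Sum>\<^sub># P}"
  shows "(x, y) \<in> (label_steps P l w)\<^sup>*"
proof (rule ccontr)
  assume notin: "(x, y) \<notin> (label_steps P l w)\<^sup>*"
  let ?N = "{1..\<Sum>\<^sub># P}" and ?q = "gluing_class P l w"
  let ?R = "side_gluing P l w \<union> (side_gluing P l w)\<inverse>"
  have lb: "bij_betw l (sides P) ?N" using l by (simp add: labellings_def)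
  have wN: "w z \<in> ?N" "w (w z) = z" if "z \<in> ?N" for z
    using w that by (auto simp: pairings_def dest: permutes_in_image)
  have phi_inj: "inj_on (polygon_perm P l) ?N"
  proof (rule inj_onI)
    fix a b assume ab: "a \<in> ?N" "b \<in> ?N" "polygon_perm P l a = polygon_perm P l b"
    then obtain s t where st: "s \<in> sides P" "t \<in> sides P" "a = l s" "b = l t"
      using lb by (metis bij_betw_imp_surj_on imageE)
    then have "l (next_side P s) = l (next_side P t)"
      using ab(3) polygon_perm_label[OF l] by simp
    then have "next_side P s = next_side P t"
      using lb st next_side_in_sides[OF P] by (meson bij_betw_imp_inj_on inj_onD)
    then show "a = b" using st inj_on_next_side by (metis inj_onD)
  qed
  have phiN: "polygon_perm P l a \<in> ?N" if a: "a \<in> ?N" for a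
  proof -
    obtain s where "s \<in> sides P" "a = l s" using lb a by (metis bij_betw_imp_surj_on imageE)
    then show ?thesis
      using polygon_perm_label[OF l] next_side_in_sides[OF P] bij_betwE[OF lb] by simp
  qed
  define O1 where "O1 = {z. (x, z) \<in> (label_steps P l w)\<^sup>*}"
  have O1N: "O1 \<subseteq> ?N"
  proof
    fix z assume "z \<in> O1"
    then have "(x, z) \<in> (label_steps P l w)\<^sup>*" by (simp add: O1_def)
    then show "z \<in> ?N" using x
    proof (induction rule: rtrancl_induct)
      case (step a b)
      then show ?case using phiN[of a] wN(1)[of a] unfolding label_steps_def by blast
    qed
  qed
  have O1_step: "polygon_perm P l z \<in> O1" "w z \<in> O1" if "z \<in> O1" for z
  proof -
    have "(z, polygon_perm P l z) \<in> label_steps P l w" "(z, w z) \<in> label_steps P l w"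
      using that O1N by (auto simp: label_steps_def)
    then show "polygon_perm P l z \<in> O1" "w z \<in> O1"
      using that unfolding O1_def by (auto intro: rtrancl_into_rtrancl)
  qed
  define A where "A = {i. \<exists>j. (i, j) \<in> sides P \<and> l (i, j) \<in> O1}"
  have all_in: "l (i, j) \<in> O1" if i: "i \<in> A" and j: "(i, j) \<in> sides P" for i j
  proof -
    obtain j0 where j0: "(i, j0) \<in> sides P" "l (i, j0) \<in> O1" using i by (auto simp: A_def)
    have "(i, (j0 + k) mod perimeter P i) \<in> sides P \<and> l (i, (j0 + k) mod perimeter P i) \<in> O1" for k
    proof (induction k)
      case 0 then show ?case using j0 by (simp add: sides_def)
    next
      case (Suc k)
      let ?s = "(i, (j0 + k) mod perimeter P i)"
      have "next_side P ?s = (i, (j0 + Suc k) mod perimeter P i)"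
        by (simp add: next_side_def mod_Suc_eq)
      then show ?case
        using Suc next_side_in_sides[OF P, of ?s] O1_step(1)[of "l ?s"] polygon_perm_label[OF l, of ?s]
        by simp
    qed
    from this[of "j + (perimeter P i - j0)"] show ?thesis
      using j j0 by (simp add: sides_def)
  qed
  have glue_A: "fst a \<in> A \<longleftrightarrow> fst b \<in> A" if ab: "(a, b) \<in> side_gluing P l w" for a b
  proof -
    obtain i j i' j' where
      s: "fst a = i" "fst b = i'" "(i, j) \<in> sides P" "(i', j') \<in> sides P" "w (l (i, j)) = l (i', j')"
      using ab by (auto simp: side_gluing_def)
    have "l (i, j) \<in> ?N" using s(3) lb by (metis bij_betwE)
    then have "w (l (i', j')) = l (i, j)" using s(5) wN(2) by metis
    then have "l (i, j) \<in> O1 \<longleftrightarrow> l (i', j') \<in> O1" using O1_step(2) s(5) by metis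
    then show ?thesis using s all_in A_def by blast
  qed
  have class_A: "fst a \<in> A \<longleftrightarrow> fst b \<in> A" if "?q a = ?q b" for a b
  proof -
    have "b \<in> ?q a" using that by (simp add: gluing_class_def)
    then have "(a, b) \<in> ?R\<^sup>*" by (simp add: gluing_class_def)
    then show ?thesis
      by (induction rule: rtrancl_induct) (use glue_A in blast)+
  qed
  define E where "E B = ?q ` (({..<num_polygons P} \<inter> B) \<times> cball 0 1)" for B
  have openE: "openin (glued_surface P l w) (E B)" if B: "B = A \<or> B = - A" for B
  proof -
    have "{a \<in> topspace (polygons P). ?q a \<in> E B} = ({..<num_polygons P} \<inter> B) \<times> cball 0 1"
    proof (rule set_eqI, rule iffI)
      fix a assume a: "a \<in> {a \<in> topspace (polygons P). ?q a \<in> E B}"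
      then obtain b where b: "b \<in> ({..<num_polygons P} \<inter> B) \<times> cball 0 1" "?q a = ?q b"
        by (auto simp only: E_def)
      then have "fst a \<in> B" using B class_A[OF b(2)] by auto
      then show "a \<in> ({..<num_polygons P} \<inter> B) \<times> cball 0 1"
        using a by (auto simp: topspace_polygons)
    qed (auto simp: E_def topspace_polygons)
    moreover have "openin (polygons P) (({..<num_polygons P} \<inter> B) \<times> cball 0 1)"
      unfolding polygons_def openin_sum_topology
    proof (intro conjI ballI)
      fix i assume "i \<in> {..<num_polygons P}"
      then have "{z. (i, z) \<in> ({..<num_polygons P} \<inter> B) \<times> cball 0 1} = {} \<or>
          {z. (i, z) \<in> ({..<num_polygons P} \<inter> B) \<times> cball 0 1} = cball (0::complex) 1" by auto
      then show "openin (top_of_set (cball 0 1))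
          {z. (i, z) \<in> ({..<num_polygons P} \<inter> B) \<times> cball (0::complex) 1}"
        by (metis openin_empty openin_subtopology_self)
    qed auto
    ultimately show ?thesis
      by (auto simp: glued_surface_def openin_quotient_topology topspace_polygons E_def)
  qed
  have disj: "E A \<inter> E (- A) = {}" 
  proof (rule ccontr)
    assume "E A \<inter> E (- A) \<noteq> {}"
    then obtain a b where "fst a \<in> A" "fst b \<in> - A" "?q a = ?q b"
      unfolding E_def by force
    then show False using class_A by blast
  qed
  have cover: "topspace (glued_surface P l w) \<subseteq> E A \<union> E (- A)"
    by (auto simp: glued_surface_def topspace_polygons E_def)
  obtain i j where ij: "(i, j) \<in> sides P" "l (i, j) = x"
    using lb x by (metis bij_betw_imp_surj_on imageE surj_pair)
  then have "i \<in> A" by (auto simp: A_def O1_def)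
  then have neA: "E A \<noteq> {}" using ij by (auto simp: E_def sides_def)
  obtain i' j' where ij': "(i', j') \<in> sides P" "l (i', j') = y"
    using lb y by (metis bij_betw_imp_surj_on imageE surj_pair)
  have "y \<notin> O1" using notin by (simp add: O1_def)
  then have "i' \<notin> A" using all_in ij' by blast
  then have neB: "E (- A) \<noteq> {}" using ij' by (auto simp: E_def sides_def)
  show False
    using conn openE[of A] openE[of "- A"] disj cover neA neB unfolding connected_space_def by blast
qed

lemma transitive_imp_connected_glued_surface:
  assumes P: "configuration P" and l: "l \<in> labellings P" and w: "w \<in> pairings (\<Sum>\<^sub># P)"
    and trans: "\<And>x y. x \<in> {1..\<Sum>\<^sub># P} \<Longrightarrow> y \<in> {1..\<Sum>\<^sub># P} \<Longrightarrow> (x, y) \<in> (label_steps P l w)\<^sup>*"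
  shows "connected_space (glued_surface P l w)"
  unfolding connected_space_def
proof (rule notI, elim exE conjE)
  fix E1 E2
  let ?X = "glued_surface P l w" and ?N = "{1..\<Sum>\<^sub># P}" and ?q = "gluing_class P l w"
  let ?R = "side_gluing P l w \<union> (side_gluing P l w)\<inverse>"
  assume E: "openin ?X E1" "openin ?X E2" "topspace ?X \<subseteq> E1 \<union> E2" "E1 \<inter> E2 = {}"
    "E1 \<noteq> {}" "E2 \<noteq> {}"
  have lb: "bij_betw l (sides P) ?N" using l by (simp add: labellings_def)
  define K where "K i = ?q ` ({i} \<times> cball 0 1)" for i
  have Kconn: "connectedin ?X (K i)" if i: "i < num_polygons P" for i
  proof -
    have "connectedin (polygons P) (Pair i ` cball 0 1)"
    proof (rule connectedin_continuous_map_image)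
      show "continuous_map (top_of_set (cball 0 1)) (polygons P) (Pair i)"
        unfolding polygons_def using i
        continuous_map_component_injection[of i "{..<num_polygons P}" "\<lambda>_. top_of_set (cball (0::complex) 1)"]
        by simp
      show "connectedin (top_of_set (cball 0 1)) (cball (0::complex) 1)"
        by (simp add: connectedin_subtopology)
    qed
    moreover have "continuous_map (polygons P) ?X ?q"
      unfolding glued_surface_def
      using quotient_imp_continuous_map[OF quotient_map_quotient_topology] .
    ultimately have "connectedin ?X (?q ` Pair i ` cball 0 1)"
      using connectedin_continuous_map_image by blast
    moreover have "Pair i ` cball (0::complex) 1 = {i} \<times> cball 0 1" by auto
    ultimately show ?thesis by (simp add: K_def)
  qed
  have Kne: "K i \<noteq> {}" for i by (auto simp: K_def)
  have Ksub: "K i \<subseteq> topspace ?X" if "i < num_polygons P" for i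
    using Kconn[OF that] by (rule connectedin_subset_topspace)
  have Kone: "K i \<subseteq> E1 \<or> K i \<subseteq> E2" if i: "i < num_polygons P" for i
  proof (rule ccontr)
    assume "\<not> (K i \<subseteq> E1 \<or> K i \<subseteq> E2)"
    then have "E1 \<inter> K i \<noteq> {}" "E2 \<inter> K i \<noteq> {}" using Ksub[OF i] E(3) by blast+
    moreover have "K i \<subseteq> E1 \<union> E2" using Ksub[OF i] E(3) by blast
    moreover have "E1 \<inter> E2 \<inter> K i = {}" using E(4) by blast
    ultimately show False
      using Kconn[OF i] E(1,2) unfolding connectedin by blast
  qed
  have cov: "topspace ?X = (\<Union>i<num_polygons P. K i)"
    by (auto simp: glued_surface_def topspace_polygons K_def)
  have glue_meet: "K i \<inter> K i' \<noteq> {}"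
    if s: "(i, j) \<in> sides P" "(i', j') \<in> sides P" "w (l (i, j)) = l (i', j')" for i j i' j'
  proof -
    let ?a = "(i, side_point (perimeter P i) j 0)" and ?b = "(i', side_point (perimeter P i') j' (1 - 0))"
    have g: "(?a, ?b) \<in> side_gluing P l w"
      unfolding side_gluing_def using s by fastforce
    have "equiv UNIV (?R\<^sup>*)"
      by (intro equivI refl_rtrancl trans_rtrancl sym_rtrancl) (auto simp: sym_Un_converse)
    moreover have "(?a, ?b) \<in> ?R\<^sup>*" using g by blast
    ultimately have "?q ?a = ?q ?b"
      unfolding gluing_class_def by (rule equiv_class_eq)
    moreover have "?q ?a \<in> K i" "?q ?b \<in> K i'"
      unfolding K_def by (auto simp: norm_side_point)
    ultimately show ?thesis by auto
  qed
  have key: "K (fst t) \<subseteq> E1" if "(l s, l t) \<in> (label_steps P l w)\<^sup>*" "s \<in> sides P" "t \<in> sides P"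
    "K (fst s) \<subseteq> E1" for s t
  proof -
    note st = that
    have "\<exists>u\<in>sides P. z = l u \<and> K (fst u) \<subseteq> E1" if "(l s, z) \<in> (label_steps P l w)\<^sup>*" for z
      using that
    proof (induction rule: rtrancl_induct)
      case base then show ?case using \<open>s \<in> sides P\<close> \<open>K (fst s) \<subseteq> E1\<close> by blast
    next
      case (step z z')
      then obtain u where u: "u \<in> sides P" "z = l u" "K (fst u) \<subseteq> E1" by blast
      from step(2) have z: "z \<in> ?N" "z' = polygon_perm P l z \<or> z' = w z"
        by (auto simp: label_steps_def)
      show ?case
      proof (cases "z' = w z")
        case False
        then have "z' = l (next_side P u)" using z u polygon_perm_label[OF l] by simp
        moreover have "fst (next_side P u) = fst u" by (cases u) (simp add: next_side_def)
        ultimately show ?thesis using u next_side_in_sides[OF P] by metis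
      next
        case True
        then have "z' \<in> ?N" using w z(1) by (metis (no_types, lifting) mem_Collect_eq pairings_def permutes_in_image)
        then obtain v where v: "v \<in> sides P" "z' = l v" using lb by (metis bij_betw_imp_surj_on imageE)
        have "K (fst u) \<inter> K (fst v) \<noteq> {}"
          using glue_meet[of "fst u" "snd u" "fst v" "snd v"] u v True by simp
        moreover have "fst v < num_polygons P" using v by (auto simp: sides_def)
        ultimately have "K (fst v) \<subseteq> E1" using Kone[of "fst v"] u(3) E(4) by blast
        then show ?thesis using v by blast
      qed
    qed
    then obtain u where "u \<in> sides P" "l t = l u" "K (fst u) \<subseteq> E1" using st(1) by blast
    then show ?thesis using st(3) lb by (metis bij_betw_imp_inj_on inj_onD)
  qed
  have "E1 \<subseteq> topspace ?X" "E2 \<subseteq> topspace ?X" using E(1,2) openin_subset by blast+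
  then obtain i1 i2 where i: "i1 < num_polygons P" "i2 < num_polygons P"
    "K i1 \<inter> E1 \<noteq> {}" "K i2 \<inter> E2 \<noteq> {}"
    using E(5,6) unfolding cov by blast
  then have "K i1 \<subseteq> E1" using Kone E(4) by blast
  moreover have sd: "(i1, 0) \<in> sides P" "(i2, 0) \<in> sides P"
    using i perimeter_pos[OF P] by (auto simp: sides_def)
  moreover have "(l (i1, 0), l (i2, 0)) \<in> (label_steps P l w)\<^sup>*"
    using trans bij_betwE[OF lb] sd by blast
  ultimately have "K i2 \<subseteq> E1" using key[of "(i1, 0)" "(i2, 0)"] by simp
  then show False using i(4) E(4) by blast
qed

lemma connected_glued_surface_iff:
  assumes "configuration P" "l \<in> labellings P" "w \<in> pairings (\<Sum>\<^sub># P)"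
  shows "connected_space (glued_surface P l w) \<longleftrightarrow>
    (\<forall>x\<in>{1..\<Sum>\<^sub># P}. \<forall>y\<in>{1..\<Sum>\<^sub># P}. (x, y) \<in> (label_steps P l w)\<^sup>*)"
  using connected_glued_surface_imp_transitive[OF assms]
    transitive_imp_connected_glued_surface[OF assms] by blast

end

theory Submission
  imports Defs "HOL-Real_Asymp.Real_Asymp"
begin

text \<open>First moment method. If the surface is disconnected, then some nonempty set of polygons with
  total perimeter \<open>2m \<le> n\<close> is glued only to itself. For a given such set this has probability
  \<open>(n choose m) / (2n choose 2m) \<le> 1 / (n choose m)\<close>, by Vandermonde. The number \<open>N m\<close> of sets of
  perimeter \<open>2m\<close> satisfies, for \<open>0 \<le> x \<le> 1\<close>,
  \<open>N m * x^(2m) \<le> (1 + x)^L * (1 + x^2)^B * (1 + x^3)^(2n/3)\<close>, since polygons other than loops and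
  bigons have perimeter at least 3. For \<open>m \<le> n / c^3\<close> the choice \<open>x^2 = c m / n\<close> gives
  \<open>N m / (n choose m) \<le> (e / c)^m\<close> for large \<open>n\<close>, which sums to something arbitrarily small as \<open>c\<close>
  grows. For larger \<open>m\<close> the choice \<open>x^3 = m / (n - m)\<close>, which makes \<open>m\<close> the mode of the
  binomial distribution with weights \<open>(n choose j) x^(3j)\<close>, gives an exponentially small bound.\<close>

section \<open>Counting fixed-point-free involutions\<close>

text \<open>Arbitrary ground sets allow a pairing to be shrunk by one pair or restricted to a block.
  Being the identity off \<open>A\<close>, a pairing is determined by its values on
  \<open>A\<close>.\<close>

definition pairings_on :: "'a set \<Rightarrow> ('a \<Rightarrow> 'a) set" where
  "pairings_on A = {w. w permutes A \<and> (\<forall>x\<in>A. w (w x) = x \<and> w x \<noteq> x)}"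

lemma pairings_eq_pairings_on: "pairings m = pairings_on {1..m}"
  by (simp add: pairings_def pairings_on_def)

lemma finite_pairings_on: "finite A \<Longrightarrow> finite (pairings_on A)"
  by (rule finite_subset[OF _ finite_permutations]) (auto simp: pairings_on_def)

lemma pairings_on_empty [simp]: "pairings_on {} = {id}"
  by (auto simp: pairings_on_def)

lemma pairings_onI:
  assumes "\<And>x. x \<in> A \<Longrightarrow> w x \<in> A \<and> w (w x) = x \<and> w x \<noteq> x" and "\<And>x. x \<notin> A \<Longrightarrow> w x = x"
  shows "w \<in> pairings_on A"
proof -
  have "bij_betw w A A"
    by (rule bij_betwI[where g = w]) (use assms in auto)
  then have "w permutes A"
    by (rule bij_imp_permutes) (use assms in auto)
  with assms show ?thesis by (auto simp: pairings_on_def)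
qed

lemma pairings_onD:
  assumes "w \<in> pairings_on A"
  shows "x \<in> A \<Longrightarrow> w x \<in> A" "x \<notin> A \<Longrightarrow> w x = x" "w (w x) = x" "x \<in> A \<Longrightarrow> w x \<noteq> x"
  using assms
  by (auto simp: pairings_on_def permutes_in_image permutes_not_in; metis permutes_not_in)+

text \<open>Once the partner of \<open>a\<close> is recorded, composing with the transposition of
  the two makes both fixed points and leaves all other pairs alone; the same transposition undoes
  this.\<close>

lemma bij_betw_pairings_on:
  assumes a: "a \<in> A"
  shows "bij_betw (\<lambda>w. (w a, Transposition.transpose a (w a) \<circ> w)) (pairings_on A)
    (SIGMA b:A - {a}. pairings_on (A - {a, b}))"
    (is "bij_betw ?f _ _")
proof -
  let ?g = "\<lambda>(b, v). Transposition.transpose a b \<circ> v"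
  show ?thesis
  proof (rule bij_betwI[where g = ?g])
    show "(\<lambda>w. (w a, Transposition.transpose a (w a) \<circ> w)) \<in> pairings_on A \<rightarrow>
        (SIGMA b:A - {a}. pairings_on (A - {a, b}))"
    proof (rule funcsetI)
      fix w assume w: "w \<in> pairings_on A"
      note D = pairings_onD[OF w]
      have inj: "w x = w y \<longleftrightarrow> x = y" for x y by (metis D(3))
      have wa: "w x = a \<longleftrightarrow> x = w a" for x by (metis D(3))
      have "Transposition.transpose a (w a) \<circ> w \<in> pairings_on (A - {a, w a})"
        by (rule pairings_onI) (use D a in \<open>auto simp: Transposition.transpose_def inj wa\<close>)
      then show "(w a, Transposition.transpose a (w a) \<circ> w) \<in> (SIGMA b:A - {a}. pairings_on (A - {a, b}))"
        using D a by auto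
    qed
    have v: "v a = a \<and> v b = b \<and> (\<forall>x. v x = a \<longleftrightarrow> x = a) \<and> (\<forall>x. v x = b \<longleftrightarrow> x = b)"
      if "v \<in> pairings_on (A - {a, b})" for v b
      using pairings_onD[OF that] by (metis Diff_iff insertCI)
    show "?g \<in> (SIGMA b:A - {a}. pairings_on (A - {a, b})) \<rightarrow> pairings_on A"
    proof (rule funcsetI)
      fix y assume "y \<in> (SIGMA b:A - {a}. pairings_on (A - {a, b}))"
      then obtain b v where y: "y = (b, v)" and b: "b \<in> A" "b \<noteq> a" and w: "v \<in> pairings_on (A - {a, b})"
        by auto
      note D = pairings_onD[OF w]
      have "Transposition.transpose a b \<circ> v \<in> pairings_on A"
        by (rule pairings_onI) (use D a b v[OF w] in \<open>auto simp: Transposition.transpose_def\<close>)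
      then show "?g y \<in> pairings_on A" by (simp add: y)
    qed
    show "?g (?f w) = w" if "w \<in> pairings_on A" for w
      by (auto simp: fun_eq_iff)
    show "?f (?g y) = y" if "y \<in> (SIGMA b:A - {a}. pairings_on (A - {a, b}))" for y
    proof -
      obtain b u where y: "y = (b, u)" "u \<in> pairings_on (A - {a, b})" using \<open>y \<in> _\<close> by auto
      show ?thesis using v[OF y(2)] by (simp add: y(1) fun_eq_iff)
    qed
  qed
qed

text \<open>The count is (2k)! / (2^k k!) = (2k-1)!!, from the 2k-1 possible partners of one point;
  the product form keeps it within the naturals.\<close>

lemma card_pairings_on:
  assumes "finite A" "card A = 2 * k"
  shows "card (pairings_on A) * (2 ^ k * fact k) = fact (2 * k)"
  using assms
proof (induction k arbitrary: A)
  case (Suc k)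
  then obtain a where a: "a \<in> A" by (metis card.empty equals0I nat.simps(3) mult_Suc_right add_Suc add_2_eq_Suc)
  have sub: "card (pairings_on (A - {a, b})) * (2 ^ k * fact k) = fact (2 * k)" if "b \<in> A - {a}" for b
    using Suc that a by (intro Suc.IH) (auto simp: card_Diff_subset)
  have "card (pairings_on A) = (\<Sum>b\<in>A - {a}. card (pairings_on (A - {a, b})))"
    using bij_betw_same_card[OF bij_betw_pairings_on[OF a]] Suc.prems(1)
    by (simp add: card_SigmaI finite_pairings_on)
  then have "card (pairings_on A) * (2 ^ k * fact k) = card (A - {a}) * fact (2 * k)"
    using sub by (simp add: sum_distrib_right)
  then have "card (pairings_on A) * (2 ^ k * fact k) = (2 * k + 1) * fact (2 * k)"
    using Suc.prems a by simp
  \<comment> \<open>\<open>2 * (k + 1)\<close> takes \<open>2 ^ k * fact k\<close> to its value at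
    \<open>Suc k\<close>, and on the right it completes \<open>fact (2 * Suc k)\<close>.\<close>
  then have "2 * (k + 1) * (card (pairings_on A) * (2 ^ k * fact k)) = 2 * (k + 1) * ((2 * k + 1) * fact (2 * k))"
    by simp
  then show ?case by (simp add: algebra_simps)
qed simp

text \<open>Deleting a point together with its partner leaves a pairing of a set with two points
  fewer.\<close>

lemma even_card_if_pairing:
  assumes "finite A" "w \<in> pairings_on A"
  shows "even (card A)"
  using assms
proof (induction "card A" arbitrary: A w rule: less_induct)
  case less
  show ?case
  proof (cases "A = {}")
    case False
    then obtain a where a: "a \<in> A" by blast
    have b: "w a \<in> A" "w a \<noteq> a" using pairings_onD[OF less.prems(2)] a by auto
    have c: "card A = Suc (Suc (card (A - {a, w a})))"
      using a b less.prems(1) by (metis Diff_insert Diff_iff card_Suc_Diff1 finite_Diff insert_iff empty_iff Diff_insert2)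
    have "Transposition.transpose a (w a) \<circ> w \<in> pairings_on (A - {a, w a})"
      using bij_betwE[OF bij_betw_pairings_on[OF a]] less.prems(2) by fastforce
    then have "even (card (A - {a, w a}))"
      using less.hyps[of "A - {a, w a}"] c less.prems(1) by simp
    then show ?thesis using c by simp
  qed simp
qed

text \<open>A pairing that maps \<open>A\<close> into itself also preserves the complement, so it is
  determined by its restrictions to \<open>A\<close> and to \<open>I - A\<close>, each extended by
  the identity.\<close>

lemma card_invariant_pairings_on_le:
  assumes I: "finite I" and A: "A \<subseteq> I"
  shows "card {w \<in> pairings_on I. w ` A \<subseteq> A} \<le> card (pairings_on A) * card (pairings_on (I - A))"
proof -
  let ?r = "\<lambda>w B x. if x \<in> B then w x else x"
  have "card {w \<in> pairings_on I. w ` A \<subseteq> A} \<le> card (pairings_on A \<times> pairings_on (I - A))"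
  proof (rule card_inj_on_le[where f = "\<lambda>w. (?r w A, ?r w (I - A))"])
    show "inj_on (\<lambda>w. (?r w A, ?r w (I - A))) {w \<in> pairings_on I. w ` A \<subseteq> A}"
    proof (rule inj_onI)
      fix w v assume "w \<in> {w \<in> pairings_on I. w ` A \<subseteq> A}" "v \<in> {w \<in> pairings_on I. w ` A \<subseteq> A}"
        and eq: "(?r w A, ?r w (I - A)) = (?r v A, ?r v (I - A))"
      then have wv: "w \<in> pairings_on I" "v \<in> pairings_on I" by auto
      show "w = v"
      proof
        fix x
        have "?r w A x = ?r v A x" "?r w (I - A) x = ?r v (I - A) x"
          using eq by (auto dest: fun_cong[of _ _ x])
        then show "w x = v x"
          using pairings_onD(2)[OF wv(1), of x] pairings_onD(2)[OF wv(2), of x] by (auto split: if_splits)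
      qed
    qed
    show "(\<lambda>w. (?r w A, ?r w (I - A))) ` {w \<in> pairings_on I. w ` A \<subseteq> A} \<subseteq> pairings_on A \<times> pairings_on (I - A)"
    proof (rule image_subsetI)
      fix w assume "w \<in> {w \<in> pairings_on I. w ` A \<subseteq> A}"
      then have w: "w \<in> pairings_on I" "w ` A \<subseteq> A" by auto
      note D = pairings_onD[OF w(1)]
      have "?r w A \<in> pairings_on A"
        by (rule pairings_onI) (use D w(2) A in auto)
      \<comment> \<open>\<open>w\<close> is its own inverse, so nothing can enter \<open>A\<close>
        from outside.\<close>
      moreover have "w x \<notin> A" if "x \<notin> A" for x using w(2) that D(3)[of x] by (metis image_subset_iff)
      then have "?r w (I - A) \<in> pairings_on (I - A)"
        by (intro pairings_onI) (use D w(2) A in auto)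
      ultimately show "(?r w A, ?r w (I - A)) \<in> pairings_on A \<times> pairings_on (I - A)"
        by simp
    qed
    show "finite (pairings_on A \<times> pairings_on (I - A))"
      using I A finite_subset by (blast intro: finite_pairings_on)
  qed
  then show ?thesis by (simp only: card_cartesian_product)
qed

lemma invariant_pairing_even:
  assumes "finite A" "w \<in> pairings_on I" "A \<subseteq> I" "w ` A \<subseteq> A"
  shows "even (card A)"
proof (rule even_card_if_pairing)
  show "(\<lambda>x. if x \<in> A then w x else x) \<in> pairings_on A"
    by (rule pairings_onI) (use pairings_onD[OF assms(2)] assms in auto)
qed fact

text \<open>The single summand \<open>k = m\<close> of Vandermonde's sum already gives the
  bound.\<close>

lemma binomial_square_le:
  assumes "m \<le> n"
  shows "(n choose m)\<^sup>2 \<le> (2 * n) choose (2 * m)"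
proof -
  have "(n choose m) * (n choose (2 * m - m)) \<le> (\<Sum>k\<le>2 * m. (n choose k) * (n choose (2 * m - k)))"
    by (rule member_le_sum) auto
  also have "\<dots> = (n + n) choose (2 * m)" by (rule vandermonde)
  finally show ?thesis by (simp add: power2_eq_square mult_2)
qed

lemma invariant_pairings_fraction:
  assumes I: "finite I" "card I = 2 * n" and A: "A \<subseteq> I" "card A = 2 * m"
  shows "card {w \<in> pairings_on I. w ` A \<subseteq> A} / card (pairings_on I) \<le> 1 / real (n choose m)"
proof -
  have mn: "m \<le> n" using card_mono[OF I(1) A(1)] I A by simp
  have fA: "finite A" using A(1) I(1) finite_subset by blast
  define D where "D k = (fact (2 * k) / (2 ^ k * fact k) :: real)" for k
  have D: "real (card (pairings_on B)) = D k" if "finite B" "card B = 2 * k" for B :: "'a set" and k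
  proof -
    have "real (card (pairings_on B)) * (2 ^ k * fact k) = fact (2 * k)"
      using arg_cong[OF card_pairings_on[OF that], of real] by simp
    then show ?thesis by (simp add: D_def field_simps)
  qed
  have c: "card (I - A) = 2 * (n - m)" using A I fA by (simp add: card_Diff_subset)
  have "real (card {w \<in> pairings_on I. w ` A \<subseteq> A}) \<le> D m * D (n - m)"
    unfolding D[OF fA A(2), symmetric] D[OF finite_Diff[OF I(1)] c, symmetric] of_nat_mult[symmetric]
    using card_invariant_pairings_on_le[OF I(1) A(1)] by (simp only: of_nat_le_iff)
  then have "card {w \<in> pairings_on I. w ` A \<subseteq> A} / card (pairings_on I) \<le> D m * D (n - m) / D n"
    unfolding D[OF I] by (intro divide_right_mono) (auto simp: D_def)
  \<comment> \<open>\<open>D k\<close> counts the pairings of \<open>2 * k\<close> points. The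
    powers of 2 cancel, and the factorials collect into the two binomial coefficients.\<close>
  also have "\<dots> = real (n choose m) / real (2 * n choose (2 * m))"
  proof -
    have "2 ^ n = (2 ^ m * 2 ^ (n - m) :: real)" using mn by (simp flip: power_add)
    moreover have "real (n choose m) = fact n / (fact m * fact (n - m))"
      using mn by (rule binomial_fact)
    moreover have "real (2 * n choose (2 * m)) = fact (2 * n) / (fact (2 * m) * fact (2 * (n - m)))"
      using mn binomial_fact[of "2 * m" "2 * n"] by (simp only: diff_mult_distrib2) simp
    ultimately show ?thesis by (simp add: D_def)
  qed
  also have "\<dots> \<le> real (n choose m) / (real (n choose m))\<^sup>2"
  proof (rule divide_left_mono)
    show "(real (n choose m))\<^sup>2 \<le> real (2 * n choose (2 * m))"
      using binomial_square_le[OF mn] by (metis of_nat_le_iff of_nat_power)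
  qed (use mn in auto)
  finally show ?thesis using mn by (simp add: power2_eq_square)
qed

section \<open>Sets of polygons of given total perimeter\<close>

text \<open>Cubed, so that all exponents are natural numbers.\<close>

lemma prod_one_plus_power_cube_le:
  fixes x :: real
  assumes "\<forall>p\<in>#M. 0 < p" and x: "0 \<le> x" "x \<le> 1"
  shows "(\<Prod>p\<in>#M. 1 + x ^ p) ^ 3
    \<le> (1 + x) ^ (3 * count M 1) * (1 + x\<^sup>2) ^ (3 * count M 2) * (1 + x ^ 3) ^ \<Sum>\<^sub># M"
  using assms(1)
proof (induction M)
  case (add p M)
  let ?F = "\<lambda>M. (1 + x) ^ (3 * count M 1) * (1 + x\<^sup>2) ^ (3 * count M 2) * (1 + x ^ 3) ^ \<Sum>\<^sub># M"
  have one: "1 \<le> (1 + x ^ 3) ^ k" for k using x by (intro one_le_power) simp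
  have F0: "0 \<le> ?F M" using x by (intro mult_nonneg_nonneg zero_le_power) auto
  have step: "(1 + x ^ p) ^ 3 * ?F M \<le> ?F (add_mset p M)"
  proof -
    \<comment> \<open>Loops and bigons are paid for by factors of their own, so their share
      \<open>(1 + x ^ 3) ^ p\<close> is a surplus of at least 1. For \<open>p >= 3\<close>,
      \<open>x ^ p <= x ^ 3\<close>, and the exponent 3 of the cube is at most
      \<open>p\<close>.\<close>
    consider "p = 1" | "p = 2" | "3 \<le> p" using add.prems by fastforce
    then show ?thesis
    proof cases
      case 1
      have "?F (add_mset p M) = (1 + x ^ p) ^ 3 * ?F M * (1 + x ^ 3) ^ p"
        using 1 by (simp add: power_add mult_ac)
      then show ?thesis using mult_left_mono[OF one, of "(1 + x ^ p) ^ 3 * ?F M" p] F0 x by simp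
    next
      case 2
      have "?F (add_mset p M) = (1 + x ^ p) ^ 3 * ?F M * (1 + x ^ 3) ^ p"
        using 2 by (simp add: power_add power2_eq_square mult_ac)
      then show ?thesis using mult_left_mono[OF one, of "(1 + x ^ p) ^ 3 * ?F M" p] F0 x by simp
    next
      case 3
      have "?F (add_mset p M) = (1 + x ^ 3) ^ p * ?F M"
        using 3 by (simp add: power_add mult_ac)
      moreover have "(1 + x ^ p) ^ 3 \<le> (1 + x ^ 3) ^ 3"
        using power_decreasing[OF 3 x] x by (intro power_mono) auto
      moreover have "(1 + x ^ 3) ^ 3 \<le> (1 + x ^ 3) ^ p"
        using 3 x by (intro power_increasing) auto
      ultimately have "(1 + x ^ p) ^ 3 \<le> (1 + x ^ 3) ^ p" by linarith
      then show ?thesis unfolding \<open>?F (add_mset p M) = _\<close> using F0 by (rule mult_right_mono)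
    qed
  qed
  have "(\<Prod>p\<in>#add_mset p M. 1 + x ^ p) ^ 3 = (1 + x ^ p) ^ 3 * (\<Prod>p\<in>#M. 1 + x ^ p) ^ 3"
    by (simp add: power_mult_distrib)
  also have "\<dots> \<le> (1 + x ^ p) ^ 3 * ?F M"
    using add x by (intro mult_left_mono) auto
  finally show ?case using step by simp
qed simp

text \<open>Sets of indices rather than submultisets: polygons of equal perimeter count as
  distinct.\<close>

definition num_subsets :: "nat multiset \<Rightarrow> nat \<Rightarrow> nat" where
  "num_subsets P s = card {S. S \<subseteq> {..<num_polygons P} \<and> sum (perimeter P) S = s}"

lemma prod_perimeter: "(\<Prod>i<num_polygons P. f (perimeter P i)) = (\<Prod>p\<in>#P. f p)"
proof -
  let ?xs = "sorted_list_of_multiset P"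
  have "(\<Prod>p\<in>#P. f p) = prod_list (map f ?xs)"
    by (subst (1) mset_sorted_list_of_multiset[symmetric], subst mset_map[symmetric]) (simp only: prod_mset_prod_list)
  also have "\<dots> = (\<Prod>i<length ?xs. f (?xs ! i))"
    by (simp add: prod.list_conv_set_nth atLeast0LessThan)
  also have "length ?xs = num_polygons P"
    by (simp add: num_polygons_def flip: size_mset)
  finally show ?thesis by (simp add: perimeter_def)
qed

text \<open>Generating function: the product expands into the sum of
  \<open>x ^ sum (perimeter P) S\<close> over all index sets \<open>S\<close>, and every summand is
  nonnegative.\<close>

lemma num_subsets_le_prod:
  fixes x :: real
  assumes "0 \<le> x"
  shows "num_subsets P s * x ^ s \<le> (\<Prod>p\<in>#P. 1 + x ^ p)"
proof -
  let ?I = "{..<num_polygons P}" and ?p = "perimeter P"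
  have "num_subsets P s * x ^ s = (\<Sum>S | S \<subseteq> ?I \<and> sum ?p S = s. x ^ sum ?p S)"
    by (simp add: num_subsets_def)
  also have "\<dots> \<le> (\<Sum>S\<in>Pow ?I. x ^ sum ?p S)"
    using assms by (intro sum_mono2) auto
  also have "\<dots> = (\<Sum>S\<in>Pow ?I. (\<Prod>i\<in>S. x ^ ?p i) * (\<Prod>i\<in>?I - S. 1))"
    by (simp add: power_sum)
  also have "\<dots> = (\<Prod>i\<in>?I. x ^ ?p i + 1)" by (rule prod_add[symmetric]) simp
  also have "\<dots> = (\<Prod>p\<in>#P. 1 + x ^ p)"
    using prod_perimeter[of "\<lambda>p. x ^ p + 1" P] by (simp add: add.commute)
  finally show ?thesis .
qed

lemma num_subsets_cube_le:
  fixes x :: real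
  assumes P: "configuration P" "config_size P = n" and x: "0 \<le> x" "x \<le> 1"
  shows "(num_subsets P s * x ^ s) ^ 3
    \<le> (1 + x) ^ (3 * num_loops P) * (1 + x\<^sup>2) ^ (3 * num_bigons P) * (1 + x ^ 3) ^ (2 * n)"
proof -
  have s: "\<Sum>\<^sub># P = 2 * n" using P by (auto simp: configuration_def config_size_def)
  have "(num_subsets P s * x ^ s) ^ 3 \<le> (\<Prod>p\<in>#P. 1 + x ^ p) ^ 3"
    using num_subsets_le_prod[OF x(1)] x by (intro power_mono) auto
  also have "\<dots> \<le> (1 + x) ^ (3 * count P 1) * (1 + x\<^sup>2) ^ (3 * count P 2) * (1 + x ^ 3) ^ \<Sum>\<^sub># P"
    using P x by (intro prod_one_plus_power_cube_le) (auto simp: configuration_def)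
  finally show ?thesis by (simp add: s num_loops_def num_bigons_def)
qed

text \<open>\<open>y\<close> is the odds p / (1 - p) for p = m / n, so up to a common factor these
  are the weights of a binomial distribution with mean \<open>m\<close>. They do not decrease up to
  \<open>m\<close> and do not increase afterwards.\<close>

lemma binomial_mode:
  fixes y :: real
  assumes m: "m < n" and j: "j \<le> n"
  defines "y \<equiv> real m / real (n - m)"
  shows "(n choose j) * y ^ j \<le> (n choose m) * y ^ m"
proof -
  define g where "g j = (n choose j) * y ^ j" for j
  have y0: "0 \<le> y" by (simp add: y_def)
  have g0: "0 \<le> g j" for j by (simp add: g_def y0)
  \<comment> \<open>The ratio of consecutive weights, (n - j) y / (j + 1), with denominators
    cleared.\<close>
  have rec: "g (Suc j) * (Suc j * (n - m)) = g j * ((n - j) * m)" for j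
  proof -
    have "real (Suc j * (n choose Suc j)) = real ((n - j) * (n choose j))"
      by (simp only: binomial_absorption binomial_absorb_comp)
    moreover have "y * real (n - m) = m" using m by (simp add: y_def)
    ultimately show ?thesis
      unfolding g_def power_Suc of_nat_mult
      by (metis (no_types, opaque_lifting) mult.assoc mult.commute)
  qed
  have pos: "0 < real (Suc j * (n - m))" for j
    using m by (simp only: of_nat_0_less_iff) simp
  have up: "g j \<le> g (Suc j)" if "j < m" for j
  proof -
    \<comment> \<open>Over the integers, where subtraction does not truncate, the right side exceeds
      the left by n (m - 1 - j) + m.\<close>
    have "int (Suc j) * (int n - int m) \<le> (int n - int j) * int m"
    proof -
      have "0 \<le> int n * (int m - 1 - int j)" using that by simp
      then show ?thesis using that by (simp add: algebra_simps)
    qed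
    then have "int (Suc j * (n - m)) \<le> int ((n - j) * m)"
      using m that by (simp only: of_nat_mult of_nat_diff less_imp_le)
    then have "real (Suc j * (n - m)) \<le> real ((n - j) * m)" by linarith
    then have "g j * (Suc j * (n - m)) \<le> g (Suc j) * (Suc j * (n - m))"
      unfolding rec using g0 by (intro mult_left_mono)
    then show ?thesis by (rule mult_right_le_imp_le) (rule pos)
  qed
  have down: "g (Suc j) \<le> g j" if "m \<le> j" "j < n" for j
  proof -
    \<comment> \<open>Here the excess is n (j - m) + (n - m).\<close>
    have "(int n - int j) * int m \<le> int (Suc j) * (int n - int m)"
    proof -
      have "int m * int n \<le> int j * int n" using that by (intro mult_right_mono) auto
      then show ?thesis using that m by (simp only: algebra_simps of_nat_Suc)
    qed
    then have "int ((n - j) * m) \<le> int (Suc j * (n - m))"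
      using m that by (simp only: of_nat_mult of_nat_diff less_imp_le)
    then have "real ((n - j) * m) \<le> real (Suc j * (n - m))" by linarith
    then have "g (Suc j) * (Suc j * (n - m)) \<le> g j * (Suc j * (n - m))"
      unfolding rec using g0 by (intro mult_left_mono)
    then show ?thesis by (rule mult_right_le_imp_le) (rule pos)
  qed
  have "g j \<le> g m"
  proof (cases "j \<le> m")
    case True
    then show ?thesis by (induction rule: inc_induct) (use up in \<open>blast intro: order_trans order_refl\<close>)+
  next
    case False
    then have "m \<le> j" by simp
    then show ?thesis using j
    proof (induction rule: dec_induct)
      case (step i)
      then show ?case using down[of i] by simp
    qed simp
  qed
  then show ?thesis by (simp add: g_def)
qed

text \<open>Each of the \<open>n + 1\<close> terms of the binomial expansion is at most the modal
  one, so only a polynomial factor is lost.\<close>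

lemma power_le_binomial_mode:
  fixes y :: real
  assumes m: "m < n"
  defines "y \<equiv> real m / real (n - m)"
  shows "(1 + y) ^ n \<le> (n + 1) * ((n choose m) * y ^ m)"
proof -
  have "(1 + y) ^ n = (\<Sum>j\<le>n. (n choose j) * y ^ j)"
    using binomial_ring[of y 1 n] by (simp add: add.commute)
  also have "\<dots> \<le> (\<Sum>j\<le>n. (n choose m) * y ^ m)"
    unfolding y_def by (intro sum_mono binomial_mode) (use m in auto)
  finally show ?thesis by (simp add: add.commute)
qed

section \<open>Bounds on single terms of the first moment sum\<close>

lemma binomial_ge_ratio_power:
  assumes "m \<le> n"
  shows "(real n / real m) ^ m \<le> (n choose m)"
  using binomial_ge_n_over_k_pow_k[OF assms, where 'a = real] by simp

text \<open>Write N for \<open>num_subsets P (2 * m)\<close> and C for \<open>n choose m\<close>. At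
  \<open>x ^ 3 = y\<close> the factor \<open>(1 + x ^ 3) ^ (2 * n)\<close> is the square of
  \<open>(1 + y) ^ n\<close>, and its modal bound carries the same power of \<open>y\<close> as the
  left side. Cancelling bounds N^3 by C^2 up to the other factors; dividing by C^3 leaves 1 / C <=
  2^(-m).\<close>

lemma large_term_bound:
  assumes P: "configuration P" "config_size P = n" and m: "0 < m" "2 * m \<le> n"
  shows "num_subsets P (2 * m) / real (n choose m)
    \<le> 2 ^ (num_loops P + num_bigons P) * real (n + 1) * 2 powr (- (m / 3))"
proof -
  let ?N = "real (num_subsets P (2 * m))" and ?C = "real (n choose m)" and ?L = "num_loops P + num_bigons P"
  define y where "y = real m / real (n - m)"
  define x where "x = root 3 y"
  have y: "0 < y" "y \<le> 1" using m by (auto simp: y_def)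
  have x: "0 < x" "x \<le> 1" "x ^ 3 = y" using y by (auto simp: x_def)
  have C: "2 ^ m \<le> ?C"
  proof -
    have "2 ^ m \<le> (real n / real m) ^ m" using m by (intro power_mono) (auto simp: field_simps)
    then show ?thesis using binomial_ge_ratio_power[of m n] m by linarith
  qed
  then have C0: "0 < ?C" using m by simp
  have "(?N * x ^ (2 * m)) ^ 3
      \<le> (1 + x) ^ (3 * num_loops P) * (1 + x\<^sup>2) ^ (3 * num_bigons P) * (1 + x ^ 3) ^ (2 * n)"
    using P x by (intro num_subsets_cube_le) auto
  also have "\<dots> \<le> 2 ^ (3 * num_loops P) * 2 ^ (3 * num_bigons P) * (real (n + 1) * (?C * y ^ m))\<^sup>2"
  proof (intro mult_mono power_mono)
    have "(1 + x ^ 3) ^ (2 * n) = ((1 + y) ^ n)\<^sup>2"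
      by (simp add: x power_mult[symmetric] mult.commute)
    also have "\<dots> \<le> (real (n + 1) * (?C * y ^ m))\<^sup>2"
      using power_le_binomial_mode[of m n, folded y_def] m y
      by (intro power_mono) (auto simp: add.commute)
    finally show "(1 + x ^ 3) ^ (2 * n) \<le> (real (n + 1) * (?C * y ^ m))\<^sup>2" .
  qed (use x in \<open>auto simp: power_le_one\<close>)
  also have "\<dots> = (2 ^ ?L) ^ 3 * (real (n + 1))\<^sup>2 * ?C\<^sup>2 * (y ^ m)\<^sup>2"
  proof -
    have "2 ^ (3 * num_loops P) * 2 ^ (3 * num_bigons P) = ((2 :: real) ^ ?L) ^ 3"
      by (simp add: power_mult[symmetric] power_add[symmetric] algebra_simps)
    then show ?thesis by (simp only: power_mult_distrib)
  qed
  also have "(?N * x ^ (2 * m)) ^ 3 = ?N ^ 3 * (y ^ m)\<^sup>2"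
  proof -
    have "(x ^ (2 * m)) ^ 3 = ((x ^ 3) ^ m)\<^sup>2"
      by (simp only: power_mult[symmetric]) (simp add: mult_ac)
    then show ?thesis by (simp add: power_mult_distrib x)
  qed
  finally have "?N ^ 3 \<le> (2 ^ ?L) ^ 3 * (real (n + 1))\<^sup>2 * ?C\<^sup>2" using y by simp
  then have "?N ^ 3 / ?C ^ 3 \<le> (2 ^ ?L) ^ 3 * (real (n + 1))\<^sup>2 * ?C\<^sup>2 / ?C ^ 3"
    using C0 by (intro divide_right_mono) auto
  also have "\<dots> = (2 ^ ?L) ^ 3 * (real (n + 1))\<^sup>2 / ?C"
    using C0 by (simp add: power2_eq_square power3_eq_cube)
  also have "\<dots> \<le> (2 ^ ?L) ^ 3 * real (n + 1) ^ 3 / 2 ^ m"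
  proof (rule frac_le)
    \<comment> \<open>Raising the exponent to 3 makes the whole bound a perfect cube, whose root can
      be taken.\<close>
    have "real (n + 1) ^ 2 \<le> real (n + 1) ^ 3" by (rule power_increasing) auto
    then show "(2 ^ ?L) ^ 3 * real (n + 1) ^ 2 \<le> (2 ^ ?L) ^ 3 * real (n + 1) ^ 3"
      by (intro mult_left_mono) auto
  qed (use C in auto)
  also have "\<dots> = (2 ^ ?L * real (n + 1) * 2 powr (- (m / 3))) ^ 3"
  proof -
    have "(2 powr (- (m / 3))) ^ 3 = 2 powr (- real m)"
      by (simp add: powr_power)
    also have "\<dots> = 1 / 2 ^ m"
      unfolding powr_minus_divide by (subst powr_realpow) auto
    finally show ?thesis by (simp only: power_mult_distrib times_divide_eq_right mult_1_right)
  qed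
  finally have "(?N / ?C) ^ 3 \<le> (2 ^ ?L * real (n + 1) * 2 powr (- (m / 3))) ^ 3"
    by (simp add: power_divide)
  then show ?thesis by (rule power_mono_iff[THEN iffD1, rotated 3]) auto
qed

text \<open>Every factor \<open>1 + u\<close> is at most \<open>exp u\<close>, and
  \<open>x ^ (2 * m) = c ^ m * (m / n) ^ m\<close>. The last power cancels against
  \<open>(n / m) ^ m <= n choose m\<close>, which leaves the gain \<open>c ^ m\<close>.\<close>

lemma small_term_bound:
  fixes c x :: real
  assumes P: "configuration P" "config_size P = n" and m: "0 < m" and c: "0 < c" "c * m \<le> n"
  defines "x \<equiv> sqrt (c * m / n)"
  shows "num_subsets P (2 * m) / real (n choose m)
    \<le> exp (num_loops P * x + num_bigons P * x\<^sup>2 + 2 / 3 * real n * x ^ 3) / c ^ m"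
    (is "_ \<le> exp ?E / _")
proof (cases "m \<le> n")
  case True
  let ?N = "real (num_subsets P (2 * m))" and ?C = "real (n choose m)"
  have n: "0 < n" using True m by simp
  have x: "0 < x" "x \<le> 1" "x\<^sup>2 = c * m / n" using m c n by (auto simp: x_def)
  have "(?N * x ^ (2 * m)) ^ 3
      \<le> (1 + x) ^ (3 * num_loops P) * (1 + x\<^sup>2) ^ (3 * num_bigons P) * (1 + x ^ 3) ^ (2 * n)"
    using P x by (intro num_subsets_cube_le) auto
  also have "\<dots> \<le> exp x ^ (3 * num_loops P) * exp (x\<^sup>2) ^ (3 * num_bigons P) * exp (x ^ 3) ^ (2 * n)"
    using x(1,2) by (intro mult_mono power_mono) auto
  also have "\<dots> = exp ?E ^ 3"
    by (simp add: exp_of_nat_mult[symmetric] exp_add[symmetric] algebra_simps)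
  finally have "?N * x ^ (2 * m) \<le> exp ?E"
    using x by (simp add: power_mono_iff)
  moreover have "x ^ (2 * m) = c ^ m * (m / n) ^ m"
    by (simp add: power_mult x power_mult_distrib[symmetric])
  ultimately have N: "?N * (m / n) ^ m \<le> exp ?E / c ^ m"
    using c by (simp add: field_simps)
  have "(n / m) ^ m \<le> ?C" using binomial_ge_ratio_power[OF True] .
  then have "?N / ?C \<le> ?N / (n / m) ^ m"
    using n m True by (intro divide_left_mono mult_pos_pos) auto
  also have "\<dots> = ?N * (m / n) ^ m"
    by (simp add: power_divide)
  finally show ?thesis using N by linarith
\<comment> \<open>For \<open>m > n\<close> the binomial coefficient is 0, and division by 0 gives
  0.\<close>
qed (use c in \<open>simp add: binomial_eq_0\<close>)

section \<open>Disconnected gluings\<close>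

text \<open>Invariance of this set under the pairing says that the polygons of \<open>S\<close> are
  glued only among themselves.\<close>

definition block :: "nat multiset \<Rightarrow> (nat \<times> nat \<Rightarrow> nat) \<Rightarrow> nat set \<Rightarrow> nat set" where
  "block P l S = l ` (SIGMA i:S. {..<perimeter P i})"

lemma block_subset:
  assumes "l \<in> labellings P" "S \<subseteq> {..<num_polygons P}"
  shows "block P l S \<subseteq> {1..\<Sum>\<^sub># P}"
proof -
  have "l ` sides P = {1..\<Sum>\<^sub># P}" using assms(1) by (simp add: labellings_def bij_betw_def)
  then show ?thesis using assms(2) unfolding block_def sides_def by blast
qed

lemma card_block:
  assumes "l \<in> labellings P" "S \<subseteq> {..<num_polygons P}"
  shows "card (block P l S) = sum (perimeter P) S"
proof -
  have "inj_on l (sides P)" using assms(1) by (simp add: labellings_def bij_betw_def)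
  then have "inj_on l (SIGMA i:S. {..<perimeter P i})"
    by (rule inj_on_subset) (use assms(2) in \<open>auto simp: sides_def\<close>)
  then have "card (block P l S) = card (SIGMA i:S. {..<perimeter P i})"
    unfolding block_def by (rule card_image)
  also have "\<dots> = sum (perimeter P) S"
    using assms(2) finite_subset by (subst card_SigmaI) auto
  finally show ?thesis .
qed

lemma block_Diff:
  assumes l: "l \<in> labellings P" and S: "S \<subseteq> {..<num_polygons P}"
  shows "block P l ({..<num_polygons P} - S) = {1..\<Sum>\<^sub># P} - block P l S"
proof -
  have "inj_on l (sides P)" "l ` sides P = {1..\<Sum>\<^sub># P}"
    using l by (auto simp: labellings_def bij_betw_def)
  moreover have "(SIGMA i:{..<num_polygons P} - S. {..<perimeter P i}) = sides P - (SIGMA i:S. {..<perimeter P i})"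
    by (auto simp: sides_def)
  moreover have "(SIGMA i:S. {..<perimeter P i}) \<subseteq> sides P" using S by (auto simp: sides_def)
  ultimately show ?thesis unfolding block_def by (simp add: inj_on_image_set_diff)
qed

text \<open>The labels reachable from one label are closed under both permutations. Closure under
  the polygon permutation makes them a union of whole polygons, and an unreachable label makes this
  union proper.\<close>

lemma disconnected_imp_invariant_block:
  assumes P: "configuration P" and l: "l \<in> labellings P" and w: "w \<in> pairings (\<Sum>\<^sub># P)"
    and disconn: "\<not> connected_space (glued_surface P l w)"
  obtains S where "S \<subseteq> {..<num_polygons P}" "S \<noteq> {}" "S \<noteq> {..<num_polygons P}"
    "w ` block P l S \<subseteq> block P l S"
proof -
  let ?N = "{1..\<Sum>\<^sub># P}"
  obtain x y where xy: "x \<in> ?N" "y \<in> ?N" "(x, y) \<notin> (label_steps P l w)\<^sup>*"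
    using disconn connected_glued_surface_iff[OF P l w] by blast
  have lb: "bij_betw l (sides P) ?N" using l by (simp add: labellings_def)
  have wN: "w z \<in> ?N" if "z \<in> ?N" for z
    using w that pairings_onD(1) by (metis pairings_eq_pairings_on)
  define R where "R = {z \<in> ?N. (x, z) \<in> (label_steps P l w)\<^sup>*}"
  have Rw: "w z \<in> R" if "z \<in> R" for z
    using that wN unfolding R_def by (auto simp: label_steps_def intro: rtrancl_into_rtrancl)
  have Rnext: "l (next_side P s) \<in> R" if "s \<in> sides P" "l s \<in> R" for s
  proof -
    have "(l s, l (next_side P s)) \<in> label_steps P l w"
      using that polygon_perm_label[OF l that(1)] by (simp add: label_steps_def R_def)
    then show ?thesis
      using that bij_betwE[OF lb] next_side_in_sides[OF P that(1)]
      unfolding R_def by (auto intro: rtrancl_into_rtrancl)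
  qed
  define S where "S = {i. \<exists>j. (i, j) \<in> sides P \<and> l (i, j) \<in> R}"
  have all_in: "l (i, j) \<in> R" if "i \<in> S" and j: "j < perimeter P i" for i j
  proof -
    obtain j0 where j0: "(i, j0) \<in> sides P" "l (i, j0) \<in> R" using \<open>i \<in> S\<close> by (auto simp: S_def)
    have "(i, (j0 + k) mod perimeter P i) \<in> sides P \<and> l (i, (j0 + k) mod perimeter P i) \<in> R" for k
    proof (induction k)
      case 0 then show ?case using j0 by (simp add: sides_def)
    next
      case (Suc k)
      let ?s = "(i, (j0 + k) mod perimeter P i)"
      have "next_side P ?s = (i, (j0 + Suc k) mod perimeter P i)"
        by (simp add: next_side_def mod_Suc_eq)
      then show ?case
        using Suc next_side_in_sides[OF P, of ?s] Rnext[of ?s] by simp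
    qed
    \<comment> \<open>This walk ends at \<open>j + perimeter P i\<close>, which is \<open>j\<close>
      modulo the perimeter, also when \<open>j < j0\<close>.\<close>
    from this[of "j + (perimeter P i - j0)"] show ?thesis
      using j j0 by (simp add: sides_def)
  qed
  have SR: "block P l S = R"
  proof
    show "block P l S \<subseteq> R" using all_in by (auto simp: block_def)
    show "R \<subseteq> block P l S"
    proof
      fix z assume z: "z \<in> R"
      then have "z \<in> l ` sides P" using lb by (auto simp: R_def bij_betw_def)
      then obtain i j where ij: "(i, j) \<in> sides P" "z = l (i, j)" by auto
      then have "i \<in> S" using z by (auto simp: S_def)
      then show "z \<in> block P l S" using ij by (auto simp: block_def sides_def)
    qed
  qed
  show thesis
  proof (rule that)
    show "S \<subseteq> {..<num_polygons P}" by (auto simp: S_def sides_def)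
    have "x \<in> R" "y \<notin> R" using xy by (auto simp: R_def)
    then show "S \<noteq> {}" using SR by (auto simp: block_def)
    have "block P l {..<num_polygons P} = ?N"
      using lb by (simp add: block_def bij_betw_def flip: sides_def)
    then show "S \<noteq> {..<num_polygons P}" using SR \<open>y \<notin> R\<close> xy(2) by metis
    show "w ` block P l S \<subseteq> block P l S" using Rw SR by auto
  qed
qed

lemma sum_perimeter_pos:
  assumes "configuration P" "S \<subseteq> {..<num_polygons P}" "S \<noteq> {}"
  shows "0 < sum (perimeter P) S"
  using assms(2,3) perimeter_pos[OF assms(1)] finite_subset[OF assms(2)] by (intro sum_pos) blast+

text \<open>Passing to the complement if necessary, the invariant block contains at most half of the sides.\<close>

lemma disconnected_imp_small_invariant_block:
  assumes P: "configuration P" "config_size P = n" and l: "l \<in> labellings P"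
    and w: "w \<in> pairings (\<Sum>\<^sub># P)" and disconn: "\<not> connected_space (glued_surface P l w)"
  obtains S m where "S \<subseteq> {..<num_polygons P}" "sum (perimeter P) S = 2 * m" "0 < m" "2 * m \<le> n"
    "w ` block P l S \<subseteq> block P l S"
proof -
  let ?k = "{..<num_polygons P}" and ?N = "{1..\<Sum>\<^sub># P}"
  have N: "\<Sum>\<^sub># P = 2 * n" using P by (auto simp: configuration_def config_size_def)
  have w': "w \<in> pairings_on ?N" using w by (simp add: pairings_eq_pairings_on)
  note result = that
  have fin: thesis if S: "S \<subseteq> ?k" "S \<noteq> {}" "w ` block P l S \<subseteq> block P l S" "sum (perimeter P) S \<le> n" for S
  proof -
    \<comment> \<open>The pairing restricts to a pairing of the block, so the perimeter has the form
      \<open>2 * m\<close>.\<close>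
    have "even (card (block P l S))"
      using block_subset[OF l S(1)] w' S(3) finite_subset[OF block_subset[OF l S(1)]]
      by (intro invariant_pairing_even) auto
    then obtain m where "sum (perimeter P) S = 2 * m" using card_block[OF l S(1)] by (auto elim: evenE)
    then show thesis using result[of S m] S sum_perimeter_pos[OF P(1) S(1,2)] by auto
  qed
  obtain S where S: "S \<subseteq> ?k" "S \<noteq> {}" "S \<noteq> ?k" "w ` block P l S \<subseteq> block P l S"
    by (rule disconnected_imp_invariant_block[OF P(1) l w disconn])
  show thesis
  proof (cases "sum (perimeter P) S \<le> n")
    case True
    then show ?thesis using fin S by blast
  next
    case False
    let ?T = "?k - S"
    have "w ` block P l ?T \<subseteq> block P l ?T"
      unfolding block_Diff[OF l S(1)]
    proof (rule image_subsetI)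
      fix z assume z: "z \<in> ?N - block P l S"
      \<comment> \<open>If \<open>w z\<close> were in the block, so would be
        \<open>z = w (w z)\<close>.\<close>
      then have "w z \<in> block P l S \<Longrightarrow> w (w z) \<in> block P l S" using S(4) by blast
      then show "w z \<in> ?N - block P l S" using z pairings_onD(1,3)[OF w'] by auto
    qed
    moreover have "sum (perimeter P) ?T \<le> n"
    proof -
      have "card (block P l ?T) = card ?N - card (block P l S)"
        unfolding block_Diff[OF l S(1)]
        using block_subset[OF l S(1)] finite_subset[OF block_subset[OF l S(1)]]
        by (intro card_Diff_subset) auto
      then show ?thesis
        using False card_block[OF l S(1)] card_block[OF l, of ?T] N by auto
    qed
    ultimately show ?thesis using fin[of ?T] S by blast
  qed
qed

section \<open>Union bound over self-glued sets of polygons\<close>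

lemma pair_pmf_of_set:
  assumes "finite A" "A \<noteq> {}" "finite B" "B \<noteq> {}"
  shows "pair_pmf (pmf_of_set A) (pmf_of_set B) = pmf_of_set (A \<times> B)"
proof (rule pmf_eqI)
  fix z :: "'a \<times> 'b"
  show "pmf (pair_pmf (pmf_of_set A) (pmf_of_set B)) z = pmf (pmf_of_set (A \<times> B)) z"
    using assms by (cases z) (simp add: pmf_pair indicator_def)
qed

text \<open>Union bound with the labelling fixed: the block of each \<open>S\<close> of perimeter
  \<open>2 * m\<close> is preserved by at most a fraction \<open>1 / (n choose m)\<close> of the
  pairings. The fraction obtained is the same for every \<open>l\<close>, so it survives averaging
  over labellings.\<close>

lemma card_disconnected_pairings_le:
  assumes P: "configuration P" "config_size P = n" and l: "l \<in> labellings P"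
  shows "card {w \<in> pairings (\<Sum>\<^sub># P). \<not> connected_space (glued_surface P l w)}
    \<le> (\<Sum>m = 1..n div 2. num_subsets P (2 * m) / real (n choose m)) * card (pairings (\<Sum>\<^sub># P))"
proof -
  let ?W = "pairings (\<Sum>\<^sub># P)" and ?F = "\<lambda>m. {S. S \<subseteq> {..<num_polygons P} \<and> sum (perimeter P) S = 2 * m}"
  let ?E = "\<lambda>S. {w \<in> ?W. w ` block P l S \<subseteq> block P l S}"
  have N: "\<Sum>\<^sub># P = 2 * n" using P by (auto simp: configuration_def config_size_def)
  have fF: "finite (?F m)" for m by simp
  have fE: "finite (?E S)" for S using finite_pairings by simp
  have "{w \<in> ?W. \<not> connected_space (glued_surface P l w)} \<subseteq> (\<Union>m\<in>{1..n div 2}. \<Union>S\<in>?F m. ?E S)"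
  proof
    fix w assume "w \<in> {w \<in> ?W. \<not> connected_space (glued_surface P l w)}"
    then have w: "w \<in> ?W" "\<not> connected_space (glued_surface P l w)" by auto
    obtain S m where "S \<subseteq> {..<num_polygons P}" "sum (perimeter P) S = 2 * m" "0 < m" "2 * m \<le> n"
      "w ` block P l S \<subseteq> block P l S"
      by (rule disconnected_imp_small_invariant_block[OF P l w])
    then have "m \<in> {1..n div 2}" "S \<in> ?F m" "w \<in> ?E S" using w(1) by auto
    then show "w \<in> (\<Union>m\<in>{1..n div 2}. \<Union>S\<in>?F m. ?E S)" by blast
  qed
  then have "card {w \<in> ?W. \<not> connected_space (glued_surface P l w)} \<le> card (\<Union>m\<in>{1..n div 2}. \<Union>S\<in>?F m. ?E S)"
    using fF fE by (intro card_mono) blast+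
  also have "\<dots> \<le> (\<Sum>m\<in>{1..n div 2}. card (\<Union>S\<in>?F m. ?E S))"
    by (rule card_UN_le) simp
  also have "\<dots> \<le> (\<Sum>m\<in>{1..n div 2}. \<Sum>S\<in>?F m. card (?E S))"
    by (intro sum_mono card_UN_le fF)
  finally have "real (card {w \<in> ?W. \<not> connected_space (glued_surface P l w)})
      \<le> (\<Sum>m\<in>{1..n div 2}. \<Sum>S\<in>?F m. real (card (?E S)))"
    by (simp flip: of_nat_sum)
  also have "\<dots> \<le> (\<Sum>m\<in>{1..n div 2}. \<Sum>S\<in>?F m. 1 / real (n choose m) * card ?W)"
  proof (intro sum_mono)
    fix m S assume "S \<in> ?F m"
    then have S: "S \<subseteq> {..<num_polygons P}" "sum (perimeter P) S = 2 * m" by auto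
    have "card (?E S) / card ?W \<le> 1 / real (n choose m)"
      unfolding pairings_eq_pairings_on
      using block_subset[OF l S(1)] card_block[OF l S(1)] S(2) N
      by (intro invariant_pairings_fraction) auto
    moreover have "0 < card ?W"
      using pairings_nonempty[of "\<Sum>\<^sub># P"] finite_pairings N by (simp add: card_gt_0_iff)
    ultimately show "card (?E S) \<le> 1 / real (n choose m) * card ?W"
      by (simp add: field_simps)
  qed
  also have "\<dots> = (\<Sum>m = 1..n div 2. num_subsets P (2 * m) / real (n choose m)) * card ?W"
    by (simp add: num_subsets_def sum_distrib_right)
  finally show ?thesis .
qed

lemma prob_disconnected_le:
  assumes P: "configuration P" "config_size P = n"
  shows "measure_pmf.prob (random_surface P) {M. \<not> connected_space M}
    \<le> (\<Sum>m = 1..n div 2. num_subsets P (2 * m) / real (n choose m))"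
proof -
  let ?W = "pairings (\<Sum>\<^sub># P)" and ?L = "labellings P"
  let ?B = "(\<Sum>m = 1..n div 2. num_subsets P (2 * m) / real (n choose m))"
  let ?D = "\<lambda>l. {w \<in> ?W. \<not> connected_space (glued_surface P l w)}"
  have W: "finite ?W" "?W \<noteq> {}"
    using P finite_pairings pairings_nonempty by (auto simp: configuration_def)
  have LW: "finite (?L \<times> ?W)" "?L \<times> ?W \<noteq> {}"
    using W finite_labellings labellings_nonempty by auto
  have "measure_pmf.prob (random_surface P) {M. \<not> connected_space M} =
      card (?L \<times> ?W \<inter> {(l, w). \<not> connected_space (glued_surface P l w)}) / card (?L \<times> ?W)"
    unfolding random_surface_def pair_pmf_of_set[OF finite_labellings labellings_nonempty W]
    by (simp add: measure_pmf_of_set[OF LW(2,1)] vimage_def case_prod_unfold)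
  also have "?L \<times> ?W \<inter> {(l, w). \<not> connected_space (glued_surface P l w)} = Sigma ?L ?D"
    by auto
  also have "real (card (Sigma ?L ?D)) = (\<Sum>l\<in>?L. real (card (?D l)))"
    using W finite_labellings by (subst card_SigmaI) auto
  also have "\<dots> / card (?L \<times> ?W) \<le> (\<Sum>l\<in>?L. ?B * card ?W) / card (?L \<times> ?W)"
    by (intro divide_right_mono sum_mono card_disconnected_pairings_le[OF P]) auto
  also have "\<dots> = ?B"
    using LW W by (simp add: card_cartesian_product card_gt_0_iff finite_labellings labellings_nonempty)
  finally show ?thesis .
qed

section \<open>Asymptotics\<close>

lemma sum_geometric_le:
  fixes q :: real
  assumes "0 \<le> q" "q \<le> 1 / 2"
  shows "(\<Sum>m = 1..k. q ^ m) \<le> 2 * q"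
proof -
  \<comment> \<open>The subtracted term carries the induction: the sum grows by
    \<open>q ^ Suc k\<close>, and \<open>2 * q ^ Suc k\<close> shrinks by at least as much since
    \<open>q <= 1 / 2\<close>.\<close>
  have "(\<Sum>m = 1..k. q ^ m) \<le> 2 * q - 2 * q ^ Suc k"
  proof (induction k)
    case (Suc k)
    have "2 * q * q ^ Suc k \<le> 1 * q ^ Suc k" using assms by (intro mult_right_mono) auto
    then show ?case using Suc by simp
  qed simp
  then show ?thesis using zero_le_power[OF assms(1), of "Suc k"] by linarith
qed

text \<open>The thresholds divide up the exponent: loops and bigons contribute at most m/6 each and
  the cubic term at most 2m/3, together m.\<close>

lemma small_term_bound_geometric:
  assumes P: "configuration P" "config_size P = n" and m: "0 < m" and c: "1 \<le> c" "c ^ 3 * m \<le> n"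
    and L: "num_loops P / sqrt n \<le> 1 / (6 * sqrt c)" and B: "num_bigons P / n \<le> 1 / (6 * c)"
  shows "num_subsets P (2 * m) / real (n choose m) \<le> (exp 1 / c) ^ m"
proof -
  define x where "x = sqrt (c * m / n)"
  have "real m \<le> c ^ 3 * m" using c m by simp
  then have n: "0 < n" using c m by linarith
  have cm: "c * m \<le> n"
  proof -
    have "c \<le> c ^ 3" using c(1) self_le_power[of c 3] by simp
    then have "c * m \<le> c ^ 3 * m" by (intro mult_right_mono) auto
    then show ?thesis using c(2) by linarith
  qed
  have x2: "x\<^sup>2 = c * m / n" using c n by (simp add: x_def)
  have "x\<^sup>2 \<le> (1 / c)\<^sup>2"
    unfolding x2 using c n by (simp add: field_simps power2_eq_square power3_eq_cube)
  \<comment> \<open>From \<open>c ^ 3 * m <= n\<close>; this brings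
    \<open>n * x ^ 3 = c * m * x\<close> down to at most \<open>m\<close>.\<close>
  then have xc: "x \<le> 1 / c" using c by (intro power2_le_imp_le[of x]) auto
  have x0: "0 \<le> x" using c by (simp add: x_def)
  \<comment> \<open>Here loops have to be few compared with sqrt n: \<open>x\<close> is of order
    sqrt (m / n), and already \<open>m = 1\<close> requires \<open>num_loops P / sqrt n\<close> to
    be small.\<close>
  have "num_loops P * x = (num_loops P / sqrt n) * (sqrt c * sqrt m)"
    by (simp add: x_def real_sqrt_mult real_sqrt_divide)
  also have "\<dots> \<le> 1 / (6 * sqrt c) * (sqrt c * sqrt m)" using L c by (intro mult_right_mono) auto
  also have "\<dots> = sqrt m / 6" using c by simp
  also have "\<dots> \<le> m / 6"
  proof -
    have "sqrt m \<le> sqrt ((real m)\<^sup>2)"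
      using m self_le_power[of "real m" 2] by (intro real_sqrt_le_mono) auto
    then show ?thesis by simp
  qed
  finally have 1: "num_loops P * x \<le> m / 6" .
  have "num_bigons P * x\<^sup>2 = num_bigons P / n * (c * m)" by (simp add: x2)
  also have "\<dots> \<le> 1 / (6 * c) * (c * m)" using B c by (intro mult_right_mono) auto
  finally have 2: "num_bigons P * x\<^sup>2 \<le> m / 6" using c by simp
  have "2 / 3 * real n * x ^ 3 = 2 / 3 * (n * x\<^sup>2) * x" by (simp add: power2_eq_square power3_eq_cube)
  also have "n * x\<^sup>2 = c * m" using n by (simp add: x2)
  also have "2 / 3 * (c * m) * x \<le> 2 / 3 * (c * m) * (1 / c)"
    using xc c by (intro mult_left_mono) auto
  finally have 3: "2 / 3 * real n * x ^ 3 \<le> 2 * m / 3" using c by simp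
  have "num_subsets P (2 * m) / real (n choose m)
      \<le> exp (num_loops P * x + num_bigons P * x\<^sup>2 + 2 / 3 * real n * x ^ 3) / c ^ m"
    unfolding x_def using P m c cm by (intro small_term_bound) auto
  also have "\<dots> \<le> exp (real m) / c ^ m"
    using 1 2 3 c by (intro divide_right_mono) auto
  finally show ?thesis by (simp add: power_divide flip: exp_of_nat_mult)
qed

text \<open>With t = n / c^3 <= m, loops and bigons each cost at most t/12 in the exponent of 2,
  against a gain of m/3 >= t/3. The net exponent is at most -t/6, uniformly in
  \<open>m\<close>.\<close>

lemma large_term_bound_uniform:
  assumes P: "configuration P" "config_size P = n" and m: "0 < m" "2 * m \<le> n" and c: "1 \<le> c" "n \<le> c ^ 3 * m"
    and L: "num_loops P / sqrt n \<le> 1 / (12 * c ^ 3)" and B: "num_bigons P / n \<le> 1 / (12 * c ^ 3)"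
  shows "num_subsets P (2 * m) / real (n choose m) \<le> real (n + 1) * 2 powr (- (n / (6 * c ^ 3)))"
proof -
  have n: "1 \<le> n" using m by simp
  have c3: "0 < c ^ 3" using c by simp
  define t where "t = n / c ^ 3"
  have "sqrt n \<le> sqrt ((real n)\<^sup>2)"
    using n self_le_power[of "real n" 2] by (intro real_sqrt_le_mono) auto
  then have sq: "sqrt n \<le> n" by simp
  have "num_loops P = num_loops P / sqrt n * sqrt n" using n by simp
  also have "\<dots> \<le> 1 / (12 * c ^ 3) * n" using L sq c3 by (intro mult_mono) auto
  finally have 1: "num_loops P \<le> t / 12" by (simp add: t_def)
  have "num_bigons P = num_bigons P / n * n" using n by simp
  also have "\<dots> \<le> 1 / (12 * c ^ 3) * n" using B by (intro mult_right_mono) auto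
  finally have 2: "num_bigons P \<le> t / 12" by (simp add: t_def)
  have 3: "t \<le> m" using c(2) c3 by (simp add: t_def field_simps)
  have "num_subsets P (2 * m) / real (n choose m)
      \<le> 2 ^ (num_loops P + num_bigons P) * real (n + 1) * 2 powr (- (m / 3))"
    by (rule large_term_bound[OF P m])
  also have "\<dots> = real (n + 1) * 2 powr (real (num_loops P + num_bigons P) + - (m / 3))"
    unfolding powr_add by (simp only: powr_realpow zero_less_numeral mult_ac)
  also have "\<dots> \<le> real (n + 1) * 2 powr (- (n / (6 * c ^ 3)))"
  proof (intro mult_left_mono powr_mono)
    have "n / (6 * c ^ 3) = t / 6" by (simp add: t_def)
    then show "real (num_loops P + num_bigons P) + - (m / 3) \<le> - (n / (6 * c ^ 3))"
      using 1 2 3 by simp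
  qed auto
  finally show ?thesis .
qed

lemma sum_terms_le:
  assumes P: "configuration P" "config_size P = n" and c: "2 * exp 1 \<le> c"
    and L: "num_loops P / sqrt n \<le> 1 / (6 * sqrt c)" "num_loops P / sqrt n \<le> 1 / (12 * c ^ 3)"
    and B: "num_bigons P / n \<le> 1 / (6 * c)" "num_bigons P / n \<le> 1 / (12 * c ^ 3)"
  shows "(\<Sum>m = 1..n div 2. num_subsets P (2 * m) / real (n choose m))
    \<le> 2 * exp 1 / c + n * real (n + 1) * 2 powr (- (n / (6 * c ^ 3)))"
proof -
  let ?q = "exp 1 / c" and ?b = "real (n + 1) * 2 powr (- (n / (6 * c ^ 3)))"
  have "1 \<le> exp (1 :: real)" by simp
  then have c1: "1 \<le> c" using c by linarith
  \<comment> \<open>Each regime is covered by one of two nonnegative summands; adding both avoids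
    splitting the sum at m = n / c^3.\<close>
  have "num_subsets P (2 * m) / real (n choose m) \<le> ?q ^ m + ?b" if "m \<in> {1..n div 2}" for m
  proof (cases "c ^ 3 * m \<le> n")
    case True
    then have "num_subsets P (2 * m) / real (n choose m) \<le> ?q ^ m"
      using P that c1 L B by (intro small_term_bound_geometric) auto
    then show ?thesis by (simp add: add_increasing2)
  next
    case False
    then have "num_subsets P (2 * m) / real (n choose m) \<le> ?b"
      using P that c1 L B by (intro large_term_bound_uniform) auto
    then show ?thesis using c1 by (simp add: add_increasing)
  qed
  then have "(\<Sum>m = 1..n div 2. num_subsets P (2 * m) / real (n choose m)) \<le> (\<Sum>m = 1..n div 2. ?q ^ m + ?b)"
    by (rule sum_mono)
  also have "\<dots> = (\<Sum>m = 1..n div 2. ?q ^ m) + real (n div 2) * ?b"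
    by (simp add: sum.distrib)
  also have "\<dots> \<le> 2 * ?q + n * ?b"
  proof (rule add_mono)
    show "(\<Sum>m = 1..n div 2. ?q ^ m) \<le> 2 * ?q"
      using c c1 by (intro sum_geometric_le) (auto simp: field_simps)
    show "real (n div 2) * ?b \<le> n * ?b" by (intro mult_right_mono) auto
  qed
  finally show ?thesis by (simp add: mult.assoc)
qed

lemma sum_terms_tendsto_0:
  assumes "good P"
  shows "(\<lambda>n. \<Sum>m = 1..n div 2. num_subsets (P n) (2 * m) / real (n choose m)) \<longlonglongrightarrow> 0"
proof (rule tendstoI)
  fix e :: real assume e: "0 < e"
  \<comment> \<open>\<open>c\<close> is fixed before \<open>n\<close> grows: the first entry keeps
    the geometric ratio \<open>exp 1 / c\<close> at most 1/2, the second makes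
    \<open>2 * exp 1 / c\<close> at most \<open>e / 2\<close>.\<close>
  define c where "c = max (2 * exp 1) (4 * exp 1 / e)"
  have c: "2 * exp 1 \<le> c" "4 * exp 1 / e \<le> c" by (auto simp: c_def)
  then have c0: "0 < c" using exp_gt_zero[of "1 :: real"] by linarith
  have ce: "2 * exp 1 / c \<le> e / 2" using c(2) c0 e by (simp add: field_simps)
  define d where "d = 1 / (6 * c ^ 3)"
  have d: "0 < d" using c0 by (simp add: d_def)
  have L: "\<forall>\<^sub>F n in sequentially. num_loops (P n) / sqrt n < b"
    and B: "\<forall>\<^sub>F n in sequentially. num_bigons (P n) / n < b" if "0 < b" for b
    using assms that unfolding good_def by (auto dest!: order_tendstoD(2))
  have "((\<lambda>n. real n * real (n + 1) * 2 powr (- (real n * d))) \<longlongrightarrow> 0) sequentially"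
    using d by real_asymp
  then have "\<forall>\<^sub>F n in sequentially. real n * real (n + 1) * 2 powr (- (real n * d)) < e / 2"
    by (rule order_tendstoD(2)) (use e in simp)
  moreover have "\<forall>\<^sub>F n in sequentially. num_loops (P n) / sqrt n < 1 / (6 * sqrt c)"
    "\<forall>\<^sub>F n in sequentially. num_loops (P n) / sqrt n < 1 / (12 * c ^ 3)"
    "\<forall>\<^sub>F n in sequentially. num_bigons (P n) / n < 1 / (6 * c)"
    "\<forall>\<^sub>F n in sequentially. num_bigons (P n) / n < 1 / (12 * c ^ 3)"
    using c0 by (auto intro!: L B)
  moreover have "\<forall>\<^sub>F n :: nat in sequentially. 1 \<le> n" by (rule eventually_ge_at_top)
  ultimately show "\<forall>\<^sub>F n in sequentially.
      dist (\<Sum>m = 1..n div 2. num_subsets (P n) (2 * m) / real (n choose m)) 0 < e"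
  proof eventually_elim
    case (elim n)
    have "configuration (P n)" "config_size (P n) = n" using assms elim by (auto simp: good_def)
    then have "(\<Sum>m = 1..n div 2. num_subsets (P n) (2 * m) / real (n choose m))
        \<le> 2 * exp 1 / c + n * real (n + 1) * 2 powr (- (n / (6 * c ^ 3)))"
      using c elim by (intro sum_terms_le) auto
    also have "\<dots> < e / 2 + e / 2"
      using ce elim(1) by (intro add_le_less_mono) (auto simp: d_def)
    finally have "(\<Sum>m = 1..n div 2. num_subsets (P n) (2 * m) / real (n choose m)) < e" by simp
    moreover have "0 \<le> (\<Sum>m = 1..n div 2. num_subsets (P n) (2 * m) / real (n choose m))"
      by (intro sum_nonneg) auto
    ultimately show ?case by (simp add: dist_real_def)
  qed
qed

theorem proposition14:
  fixes P :: "nat \<Rightarrow> nat multiset"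
  assumes "good P"
  shows "(\<lambda>n. measure_pmf.prob (random_surface (P n)) {M. connected_space M}) \<longlonglongrightarrow> 1"
proof (rule tendsto_sandwich)
  let ?B = "\<lambda>n. \<Sum>m = 1..n div 2. num_subsets (P n) (2 * m) / real (n choose m)"
  show "(\<lambda>n. 1 - ?B n) \<longlonglongrightarrow> 1"
    using tendsto_diff[OF tendsto_const sum_terms_tendsto_0[OF assms], of 1] by simp
  \<comment> \<open>\<open>good\<close> constrains only indices \<open>n >= 1\<close>, hence the
    eventual comparison. The upper side of the sandwich is the constant 1.\<close>
  show "\<forall>\<^sub>F n in sequentially.
      1 - ?B n \<le> measure_pmf.prob (random_surface (P n)) {M. connected_space M}"
    using eventually_ge_at_top[of 1]
  proof eventually_elim
    case (elim n)
    have "measure_pmf.prob (random_surface (P n)) {M. connected_space M} =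
        1 - measure_pmf.prob (random_surface (P n)) {M. \<not> connected_space M}"
      using measure_pmf.prob_compl[of "{M. \<not> connected_space M}" "random_surface (P n)"]
      by (simp add: Compl_eq_Diff_UNIV[symmetric] Collect_neg_eq)
    then show ?case
      using prob_disconnected_le[of "P n" n] assms elim by (auto simp: good_def)
  qed
qed (auto intro!: tendsto_const)

end
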